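(* Let $n\ge 1$ and let $I_{2,n}\subset\mathbb{C}[P_J]$ be the ideal of Plücker relations of the Grassmannian $\mathbb{G}_{2,n}$ of $2$-dimensional subspaces of $\mathbb{C}^{2+n}$. Non-Crossing Monomials are exactly the non-initial monomials of $I_{2,n}$ with respect to $\prec$.
   Context: The variables $P_J$ are indexed by pairs $J=(j_1,j_2)$ with $1\le j_1<j_2\le n+2$. $I_{2,n}$ is the ideal of all polynomial relations among the $2\times2$ minors $P_J$ (on columns $J$) of a generic $2\times(n+2)$ matrix; it is generated by the Plücker relations $P_{(a,b)}P_{(c,d)}-P_{(a,c)}P_{(b,d)}+P_{(a,d)}P_{(b,c)}$, $a<b<c<d$. A monomial $P_{J^1}\cdots P_{J^h}$ is non-crossing (a Non-Crossing Monomial) if there are no $p,q$ with $j_1^p<j_1^q<j_2^p<j_2^q$. The weight of $J=(j_1,j_2)$ is $w(J)=j_2-j_1$, and $w(P_{J^1}\cdots P_{J^h})=w(J^1)\cdots w(J^h)$. The order $\prec$ is the order on monomials that is reverse to weight: $M\prec M'$ whenever $w(M)>w(M')$, monomials of equal weight being ordered arbitrarily (so as to give a total order). The initial monomial $in_\prec(f)$ of a nonzero polynomial $f$ is the minimal monomial, with respect to $\prec$, occurring with nonzero coefficient in $f$. The initial ideal $in_\prec(I_{2,n})$ is the ideal generated by the initial monomials of all nonzero elements of $I_{2,n}$. A monomial is non-initial if it does not belong to $in_\prec(I_{2,n})$. *)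

theory Defs
  imports Complex_Main "HOL-Library.Poly_Mapping" "HOL-Algebra.Ideal"
begin

section \<open>Polynomial rings over the complex numbers\<close>

text \<open>
  A monomial in variables indexed by \<open>'i\<close> is its (finitely supported) exponent function, written
  additively; a polynomial is a finitely supported function from monomials to coefficients.
\<close>

type_synonym 'i monomial = "'i \<Rightarrow>\<^sub>0 nat"
type_synonym 'i polynomial = "'i monomial \<Rightarrow>\<^sub>0 complex"

definition monomials :: "'i set \<Rightarrow> 'i monomial set" where
  "monomials V = {M. Poly_Mapping.keys M \<subseteq> V}"

definition poly_ring :: "'i set \<Rightarrow> 'i polynomial ring" where
  "poly_ring V =
     \<lparr> carrier = {f. Poly_Mapping.keys f \<subseteq> monomials V},
       mult = (*), one = 1, zero = 0, add = (+) \<rparr>"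

definition monomial_poly :: "'i monomial \<Rightarrow> 'i polynomial" where
  "monomial_poly M = Poly_Mapping.single M 1"

definition variable :: "'i \<Rightarrow> 'i polynomial" where
  "variable i = monomial_poly (Poly_Mapping.single i 1)"

text \<open>\<open>substitute s\<close> is the \<open>\<complex>\<close>-algebra homomorphism sending the variable \<open>i\<close> to \<open>s i\<close>.\<close>

definition substitute :: "('i \<Rightarrow> 'j polynomial) \<Rightarrow> 'i polynomial \<Rightarrow> 'j polynomial" where
  "substitute s f =
     (\<Sum>M \<in> Poly_Mapping.keys f.
        Poly_Mapping.single 0 (Poly_Mapping.lookup f M) *
        (\<Prod>i \<in> Poly_Mapping.keys M. s i ^ Poly_Mapping.lookup M i))"

lemma substitute_variable: "substitute s (variable i) = s i"
  by (simp add: substitute_def variable_def monomial_poly_def single_one)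

lemma cring_poly_ring: "cring (poly_ring V)"
proof (rule cringI)
  show "abelian_group (poly_ring V)"
  proof (rule abelian_groupI)
    fix x y assume "x \<in> carrier (poly_ring V)" "y \<in> carrier (poly_ring V)"
    then show "x \<oplus>\<^bsub>poly_ring V\<^esub> y \<in> carrier (poly_ring V)"
      using Poly_Mapping.keys_add[of x y] by (auto simp: poly_ring_def)
  next
    fix x assume "x \<in> carrier (poly_ring V)"
    then show "\<exists>y \<in> carrier (poly_ring V). y \<oplus>\<^bsub>poly_ring V\<^esub> x = \<zero>\<^bsub>poly_ring V\<^esub>"
      by (intro bexI[of _ "- x"]) (auto simp: poly_ring_def)
  qed (auto simp: poly_ring_def algebra_simps)
  show "comm_monoid (poly_ring V)"
  proof (rule comm_monoidI)
    fix x y assume *: "x \<in> carrier (poly_ring V)" "y \<in> carrier (poly_ring V)"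
    have "a + b \<in> monomials V" if "a \<in> monomials V" "b \<in> monomials V" for a b :: "'a monomial"
      using that Poly_Mapping.keys_add[of a b] by (auto simp: monomials_def)
    then show "x \<otimes>\<^bsub>poly_ring V\<^esub> y \<in> carrier (poly_ring V)"
      using * Poly_Mapping.keys_mult[of x y] by (fastforce simp: poly_ring_def)
  qed (auto simp: poly_ring_def monomials_def algebra_simps)
qed (auto simp: poly_ring_def algebra_simps)


section \<open>The ideal of the Grassmannian\<close>

definition plucker_indices :: "nat \<Rightarrow> (nat \<times> nat) set" where
  "plucker_indices n = {(j1, j2). 1 \<le> j1 \<and> j1 < j2 \<and> j2 \<le> n + 2}"

definition matrix_indices :: "nat \<Rightarrow> (nat \<times> nat) set" where
  "matrix_indices n = {1..2} \<times> {1..n + 2}"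

text \<open>The \<open>2 \<times> 2\<close> minor of the generic matrix on the given pair of columns.\<close>

fun minor :: "nat \<times> nat \<Rightarrow> (nat \<times> nat) polynomial" where
  "minor (j1, j2) = variable (1, j1) * variable (2, j2) - variable (1, j2) * variable (2, j1)"

definition plucker_ideal :: "nat \<Rightarrow> (nat \<times> nat) polynomial set" where
  "plucker_ideal n =
     a_kernel (poly_ring (plucker_indices n)) (poly_ring (matrix_indices n)) (substitute minor)"


section \<open>Non-crossing monomials, weights and initial monomials\<close>

text \<open>
  The variables occurring in \<open>M\<close> are its keys; multiplicities are irrelevant, as no pair crosses
  itself.
\<close>

definition non_crossing :: "(nat \<times> nat) monomial \<Rightarrow> bool" where
  "non_crossing M \<longleftrightarrow>
     \<not> (\<exists>p \<in> Poly_Mapping.keys M. \<exists>q \<in> Poly_Mapping.keys M.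
          fst p < fst q \<and> fst q < snd p \<and> snd p < snd q)"

definition weight :: "(nat \<times> nat) monomial \<Rightarrow> nat" where
  "weight M = (\<Prod>J \<in> Poly_Mapping.keys M. (snd J - fst J) ^ Poly_Mapping.lookup M J)"

text \<open>
  A strict total order on the monomials in which larger weight means smaller; ties are broken in an
  arbitrary way, in particular without any compatibility with multiplication.
\<close>

definition reverse_weight_order ::
    "nat \<Rightarrow> ((nat \<times> nat) monomial \<Rightarrow> (nat \<times> nat) monomial \<Rightarrow> bool) \<Rightarrow> bool" where
  "reverse_weight_order n prec \<longleftrightarrow>
     (let X = monomials (plucker_indices n) in
        irreflp_on X prec \<and> transp_on X prec \<and> totalp_on X prec \<and>
        (\<forall>M \<in> X. \<forall>M' \<in> X. weight M > weight M' \<longrightarrow> prec M M'))"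

text \<open>The initial monomial is the minimal, not the maximal, one.\<close>

definition initial_monomial ::
    "('i monomial \<Rightarrow> 'i monomial \<Rightarrow> bool) \<Rightarrow> 'i polynomial \<Rightarrow> 'i monomial" where
  "initial_monomial prec f =
     (THE M. M \<in> Poly_Mapping.keys f \<and>
             (\<forall>M' \<in> Poly_Mapping.keys f. M' \<noteq> M \<longrightarrow> prec M M'))"

definition initial_ideal ::
    "'i set \<Rightarrow> ('i monomial \<Rightarrow> 'i monomial \<Rightarrow> bool) \<Rightarrow> 'i polynomial set \<Rightarrow> 'i polynomial set" where
  "initial_ideal V prec I =
     genideal (poly_ring V) {monomial_poly (initial_monomial prec f) |f. f \<in> I \<and> f \<noteq> 0}"

definition non_initial_monomials ::
    "'i set \<Rightarrow> ('i monomial \<Rightarrow> 'i monomial \<Rightarrow> bool) \<Rightarrow> 'i polynomial set \<Rightarrow> 'i monomial set" where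
  "non_initial_monomials V prec I =
     {M \<in> monomials V. monomial_poly M \<notin> initial_ideal V prec I}"

end

theory Submission
  imports Defs
begin

text \<open>
  By the Ptolemy relation among the weights, the crossing term of each Pluecker relation is strictly
  heavier than the other two terms. Hence every crossing monomial is initial, and modulo the ideal it
  is a combination of strictly lighter non-crossing monomials. The non-crossing monomials are
  linearly independent modulo the ideal: grade the matrix variables by giving \<open>x\<^sub>1\<^sub>j\<close> degree \<open>0\<close> and
  \<open>x\<^sub>2\<^sub>j\<close> degree \<open>j\<close>; the unique top-degree term of a product of minors is the product of its diagonal
  terms, and it determines a non-crossing monomial just as a word of parentheses determines its
  matching. So straightening an element of the ideal gives zero, while it would not affect the
  coefficient of a non-crossing monomial of maximal weight. This uses only the weights and is
  therefore insensitive to how ties are broken. Since no crossing disappears under multiplication,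
  the initial monomials generate an ideal of polynomials with only crossing terms.
\<close>

section \<open>Monomials and substitution\<close>

text \<open>Natural exponents cannot cancel, so nothing is lost from either support.\<close>

lemma keys_add_nat:
  fixes M N :: "'i monomial"
  shows "Poly_Mapping.keys (M + N) = Poly_Mapping.keys M \<union> Poly_Mapping.keys N"
  by (auto simp: in_keys_iff lookup_add)

lemma monomials_add: "M + N \<in> monomials V \<longleftrightarrow> M \<in> monomials V \<and> N \<in> monomials V"
  by (auto simp: monomials_def keys_add_nat)

lemma monomials_single [simp]: "Poly_Mapping.single i (Suc 0) \<in> monomials V \<longleftrightarrow> i \<in> V"
  by (simp add: monomials_def)

lemma single_plus_minus:
  fixes M :: "'i monomial"
  assumes "i \<in> Poly_Mapping.keys M"
  shows "M = Poly_Mapping.single i 1 + (M - Poly_Mapping.single i 1)"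
  using assms
  by (intro poly_mapping_eqI) (auto simp: in_keys_iff lookup_add lookup_minus lookup_single when_def)

lemma sum_lookup_single_plus:
  fixes M :: "'i monomial"
  assumes "M = Poly_Mapping.single i 1 + R"
  shows "(\<Sum>j\<in>Poly_Mapping.keys M. Poly_Mapping.lookup M j) =
    Suc (\<Sum>j\<in>Poly_Mapping.keys R. Poly_Mapping.lookup R j)"
proof -
  have "(\<Sum>j\<in>Poly_Mapping.keys M. Poly_Mapping.lookup M j) =
      (\<Sum>j\<in>Poly_Mapping.keys (Poly_Mapping.single i (1::nat)).
         Poly_Mapping.lookup (Poly_Mapping.single i (1::nat)) j) +
      (\<Sum>j\<in>Poly_Mapping.keys R. Poly_Mapping.lookup R j)"
    unfolding assms by (rule setsum_keys_plus_distrib) auto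
  then show ?thesis by simp
qed

text \<open>Induction on the total degree: splitting off one occurring variable lowers it by
  one.\<close>

lemma monomial_induct [case_names zero add]:
  fixes M :: "'i monomial"
  assumes "P 0" and "\<And>i M. P M \<Longrightarrow> P (Poly_Mapping.single i 1 + M)"
  shows "P M"
proof (induction "\<Sum>i\<in>Poly_Mapping.keys M. Poly_Mapping.lookup M i" arbitrary: M rule: less_induct)
  case less
  show ?case
  proof (cases "M = 0")
    case False
    then obtain i where i: "i \<in> Poly_Mapping.keys M" by fastforce
    define R where "R = M - Poly_Mapping.single i 1"
    have M: "M = Poly_Mapping.single i 1 + R"
      using single_plus_minus[OF i] by (simp add: R_def)
    show ?thesis
      using less[of R] assms(2)[of R i] M sum_lookup_single_plus[OF M] by simp
  qed (use assms in simp)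
qed

text \<open>Values lie in an arbitrary commutative monoid, so that one multiplicativity law serves
  both the weights and the products of minors.\<close>

definition monom_val :: "('i \<Rightarrow> 'a::comm_monoid_mult) \<Rightarrow> 'i monomial \<Rightarrow> 'a" where
  "monom_val h M = (\<Prod>i\<in>Poly_Mapping.keys M. h i ^ Poly_Mapping.lookup M i)"

lemma monom_val_superset:
  assumes "finite A" "Poly_Mapping.keys M \<subseteq> A"
  shows "monom_val h M = (\<Prod>i\<in>A. h i ^ Poly_Mapping.lookup M i)"
  unfolding monom_val_def using assms by (intro prod.mono_neutral_left) (auto simp: in_keys_iff)

lemma monom_val_add: "monom_val h (M + N) = monom_val h M * monom_val h N"
proof -
  \<comment> \<open>Over the union of the supports all three products share an index set; the extra
    factors are zeroth powers.\<close>
  let ?A = "Poly_Mapping.keys M \<union> Poly_Mapping.keys N"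
  have "monom_val h L = (\<Prod>i\<in>?A. h i ^ Poly_Mapping.lookup L i)" if "L \<in> {M, N, M + N}" for L
    by (rule monom_val_superset) (use that in \<open>auto simp: keys_add_nat\<close>)
  then show ?thesis by (simp add: lookup_add power_add prod.distrib)
qed

lemma monom_val_zero [simp]: "monom_val h 0 = 1"
  by (simp add: monom_val_def)

lemma monom_val_single [simp]: "monom_val h (Poly_Mapping.single i (Suc 0)) = h i"
  by (simp add: monom_val_def)

section \<open>Linearity of substitution\<close>

lemma substitute_altdef:
  "substitute s f = (\<Sum>M\<in>Poly_Mapping.keys f.
     Poly_Mapping.single 0 (Poly_Mapping.lookup f M) * monom_val s M)"
  by (simp add: substitute_def monom_val_def)

lemma substitute_zero [simp]: "substitute s 0 = 0"
  by (simp add: substitute_altdef)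

lemma substitute_add: "substitute s (f + g) = substitute s f + substitute s g"
  unfolding substitute_altdef
  by (rule setsum_keys_plus_distrib) (auto simp: single_add algebra_simps)

lemma substitute_diff: "substitute s (f - g) = substitute s f - substitute s g"
  using substitute_add[of s "f - g" g] by (simp add: algebra_simps)

lemma substitute_sum: "substitute s (sum f A) = (\<Sum>x\<in>A. substitute s (f x))"
  by (induction A rule: infinite_finite_induct) (auto simp: substitute_add)

lemma substitute_monomial_poly: "substitute s (monomial_poly M) = monom_val s M"
  by (simp add: substitute_altdef monomial_poly_def)

lemma lookup_const_mult:
  fixes g :: "'i polynomial"
  shows "Poly_Mapping.lookup (Poly_Mapping.single 0 c * g) M = c * Poly_Mapping.lookup g M"
  unfolding mult_map_scale_conv_mult[symmetric] by (simp add: map.rep_eq when_def)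

lemma substitute_const_mult:
  "substitute s (Poly_Mapping.single 0 c * g) = Poly_Mapping.single 0 c * substitute s g"
proof -
  \<comment> \<open>Summing over the support of \<open>g\<close> also covers \<open>c = 0\<close>,
    where the product has smaller support.\<close>
  have "substitute s (Poly_Mapping.single 0 c * g) =
      (\<Sum>M\<in>Poly_Mapping.keys g.
         Poly_Mapping.single 0 (Poly_Mapping.lookup (Poly_Mapping.single 0 c * g) M) * monom_val s M)"
    unfolding substitute_altdef
    by (rule sum.mono_neutral_left) (auto simp: in_keys_iff lookup_const_mult)
  also have "\<dots> = (\<Sum>M\<in>Poly_Mapping.keys g. Poly_Mapping.single 0 c *
      (Poly_Mapping.single 0 (Poly_Mapping.lookup g M) * monom_val s M))"
    by (intro sum.cong refl) (simp add: lookup_const_mult mult_single flip: mult.assoc)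
  finally show ?thesis by (simp add: substitute_altdef sum_distrib_left)
qed

lemma plucker_ideal_iff:
  "f \<in> plucker_ideal n \<longleftrightarrow>
     Poly_Mapping.keys f \<subseteq> monomials (plucker_indices n) \<and> substitute minor f = 0"
  by (auto simp: plucker_ideal_def a_kernel_def' poly_ring_def)


section \<open>Resolving a crossing\<close>

lemma weight_altdef: "weight M = monom_val (\<lambda>J. snd J - fst J) M"
  by (simp add: weight_def monom_val_def)

lemma weight_add: "weight (M + N) = weight M * weight N"
  by (simp add: weight_altdef monom_val_add)

lemma weight_pos:
  assumes "M \<in> monomials (plucker_indices n)"
  shows "weight M > 0"
  using assms unfolding weight_def
  by (intro prod_pos) (auto simp: monomials_def plucker_indices_def subset_iff)

lemma non_crossing_mono:
  "non_crossing N \<Longrightarrow> Poly_Mapping.keys M \<subseteq> Poly_Mapping.keys N \<Longrightarrow> non_crossing M"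
  unfolding non_crossing_def by blast

text \<open>
  The weights satisfy the Ptolemy relation \<open>(c - a) (d - b) = (b - a) (d - c) + (d - a) (c - b)\<close>, so
  both monomials that replace a crossing are strictly lighter.
\<close>

lemma resolve_crossing:
  assumes M: "M \<in> monomials (plucker_indices n)" and "\<not> non_crossing M"
  obtains M1 M2 where
    "M1 \<in> monomials (plucker_indices n)" "M2 \<in> monomials (plucker_indices n)"
    "weight M1 < weight M" "weight M2 < weight M"
    "monom_val minor M = monom_val minor M1 + monom_val minor M2"
proof -
  obtain a b c d where k: "(a, c) \<in> Poly_Mapping.keys M" "(b, d) \<in> Poly_Mapping.keys M"
    and l: "a < b" "b < c" "c < d"
    using assms(2) unfolding non_crossing_def by auto
  define s :: "nat \<times> nat \<Rightarrow> (nat \<times> nat) monomial" where "s J = Poly_Mapping.single J 1" for J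
  define R where "R = M - s (a, c) - s (b, d)"
  \<comment> \<open>Since \<open>a < b\<close>, the two pairs differ, so removing one occurrence of
    the first leaves the second in place.\<close>
  have "(b, d) \<in> Poly_Mapping.keys (M - s (a, c))"
    using k(2) l by (auto simp: in_keys_iff lookup_minus s_def lookup_single when_def)
  then have MR: "M = s (a, c) + s (b, d) + R"
    using single_plus_minus[OF k(1)] single_plus_minus[of "(b, d)" "M - s (a, c)"]
    by (simp add: s_def R_def add.assoc)
  have mR: "R \<in> monomials (plucker_indices n)"
    and ind: "(a, c) \<in> plucker_indices n" "(b, d) \<in> plucker_indices n"
    using M unfolding MR by (auto simp: monomials_add s_def)
  let ?M1 = "s (a, b) + s (c, d) + R" and ?M2 = "s (a, d) + s (b, c) + R"
  have pos: "weight R > 0" using weight_pos[OF mR] .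
  \<comment> \<open>In terms of the gaps, truncated subtraction disappears and the weights compare
    by \<open>(x + y) * (y + z) = x * z + (x + y + z) * y\<close>, with both summands
    positive.\<close>
  obtain x y z where xyz: "b = a + x" "c = a + x + y" "d = a + x + y + z" "x > 0" "y > 0" "z > 0"
    using l by (metis less_imp_add_positive)
  have w: "weight M = (x + y) * (y + z) * weight R" "weight ?M1 = x * z * weight R"
    "weight ?M2 = (x + y + z) * y * weight R"
    unfolding MR by (simp_all add: weight_add, simp_all add: weight_altdef s_def xyz)
  show ?thesis
  proof (rule that[of ?M1 ?M2])
    show "?M1 \<in> monomials (plucker_indices n)" "?M2 \<in> monomials (plucker_indices n)"
      using mR ind l by (auto simp: monomials_add s_def plucker_indices_def)
    show "weight ?M1 < weight M" "weight ?M2 < weight M"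
      unfolding w using pos xyz by (auto simp: algebra_simps)
    \<comment> \<open>Once the minors are expanded, this is the three-term Pluecker relation times
      the value of \<open>R\<close>.\<close>
    show "monom_val minor M = monom_val minor ?M1 + monom_val minor ?M2"
      unfolding MR by (simp add: monom_val_add s_def algebra_simps)
  qed
qed

text \<open>Resolving a crossing yields two lighter monomials, so induction on the weight
  terminates. The case distinction keeps track of weights: only a monomial that is already
  non-crossing may retain its own weight.\<close>

lemma straightening:
  assumes "M \<in> monomials (plucker_indices n)"
  shows "\<exists>g. Poly_Mapping.keys g \<subseteq> {N \<in> monomials (plucker_indices n). non_crossing N} \<and>
    (if non_crossing M then g = monomial_poly M else \<forall>N\<in>Poly_Mapping.keys g. weight N < weight M) \<and>
    substitute minor g = monom_val minor M"
  using assms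
proof (induction "weight M" arbitrary: M rule: less_induct)
  case less
  show ?case
  proof (cases "non_crossing M")
    case True
    then show ?thesis
      using less.prems
      by (intro exI[of _ "monomial_poly M"]) (simp add: substitute_monomial_poly, simp add: monomial_poly_def)
  next
    case False
    obtain M1 M2 where m: "M1 \<in> monomials (plucker_indices n)" "M2 \<in> monomials (plucker_indices n)"
      "weight M1 < weight M" "weight M2 < weight M"
      and e: "monom_val minor M = monom_val minor M1 + monom_val minor M2"
      using resolve_crossing[OF less.prems False] by blast
    \<comment> \<open>The expansion of \<open>L\<close> has no term heavier than \<open>L\<close>,
      whether \<open>L\<close> crosses or not; hence all its terms are strictly lighter than
      \<open>M\<close>.\<close>
    have *: "\<exists>g. Poly_Mapping.keys g \<subseteq> {N \<in> monomials (plucker_indices n). non_crossing N} \<and>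
      (\<forall>N\<in>Poly_Mapping.keys g. weight N < weight M) \<and> substitute minor g = monom_val minor L"
      if L: "L \<in> monomials (plucker_indices n)" "weight L < weight M" for L
    proof -
      obtain g where "Poly_Mapping.keys g \<subseteq> {N \<in> monomials (plucker_indices n). non_crossing N}"
        "if non_crossing L then g = monomial_poly L else \<forall>N\<in>Poly_Mapping.keys g. weight N < weight L"
        "substitute minor g = monom_val minor L"
        using less.hyps[OF L(2,1)] by blast
      then show ?thesis
        using L by (intro exI[of _ g]) (auto simp: monomial_poly_def split: if_splits)
    qed
    obtain g1 g2 where
      "Poly_Mapping.keys g1 \<subseteq> {N \<in> monomials (plucker_indices n). non_crossing N}"
      "\<forall>N\<in>Poly_Mapping.keys g1. weight N < weight M" "substitute minor g1 = monom_val minor M1"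
      "Poly_Mapping.keys g2 \<subseteq> {N \<in> monomials (plucker_indices n). non_crossing N}"
      "\<forall>N\<in>Poly_Mapping.keys g2. weight N < weight M" "substitute minor g2 = monom_val minor M2"
      using *[OF m(1,3)] *[OF m(2,4)] by auto
    then show ?thesis
      using False e Poly_Mapping.keys_add[of g1 g2]
      by (intro exI[of _ "g1 + g2"]) (auto simp: substitute_add)
  qed
qed


section \<open>Linear independence of the non-crossing monomials\<close>

definition row2_degree :: "(nat \<times> nat) monomial \<Rightarrow> nat" where
  "row2_degree m =
     (\<Sum>i\<in>Poly_Mapping.keys m. Poly_Mapping.lookup m i * (if fst i = 2 then snd i else 0))"

lemma row2_degree_add: "row2_degree (m + m') = row2_degree m + row2_degree m'"
  unfolding row2_degree_def by (rule setsum_keys_plus_distrib) (auto simp: algebra_simps)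

lemma row2_degree_single [simp]:
  "row2_degree (Poly_Mapping.single i (Suc 0)) = (if fst i = 2 then snd i else 0)"
  by (simp add: row2_degree_def)

text \<open>\<open>row2_degree\<close> is only a grading, not an order on monomials; the strict
  bound on the remainder is what singles out \<open>d\<close>.\<close>

definition has_leading :: "(nat \<times> nat) polynomial \<Rightarrow> (nat \<times> nat) monomial \<Rightarrow> bool" where
  "has_leading f d \<longleftrightarrow>
     (\<exists>r. f = monomial_poly d + r \<and> (\<forall>m\<in>Poly_Mapping.keys r. row2_degree m < row2_degree d))"

text \<open>Degrees add, so a product of two terms reaches the degree of \<open>d + e\<close> only
  if both factors are leading.\<close>

lemma has_leading_mult:
  assumes "has_leading f d" "has_leading g e"
  shows "has_leading (f * g) (d + e)"
proof -
  obtain r t where f: "f = monomial_poly d + r" "\<forall>m\<in>Poly_Mapping.keys r. row2_degree m < row2_degree d"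
    and g: "g = monomial_poly e + t" "\<forall>m\<in>Poly_Mapping.keys t. row2_degree m < row2_degree e"
    using assms unfolding has_leading_def by auto
  have "f * g = monomial_poly (d + e) + (monomial_poly d * t + r * g)"
    unfolding f g by (simp add: algebra_simps monomial_poly_def mult_single)
  moreover have "row2_degree m < row2_degree (d + e)"
    if "m \<in> Poly_Mapping.keys (monomial_poly d * t + r * g)" for m
  proof -
    have g': "row2_degree k \<le> row2_degree e" if "k \<in> Poly_Mapping.keys g" for k
      using that g Poly_Mapping.keys_add[of "monomial_poly e" t] by (fastforce simp: monomial_poly_def)
    from that consider "m \<in> Poly_Mapping.keys (monomial_poly d * t)" | "m \<in> Poly_Mapping.keys (r * g)"
      using Poly_Mapping.keys_add[of "monomial_poly d * t" "r * g"] by blast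
    then show ?thesis
    proof cases
      case 1
      then obtain k where "k \<in> Poly_Mapping.keys t" "m = d + k"
        using Poly_Mapping.keys_mult[of "monomial_poly d" t] by (auto simp: monomial_poly_def)
      then show ?thesis using g(2) by (simp add: row2_degree_add)
    next
      case 2
      then obtain j k where "j \<in> Poly_Mapping.keys r" "k \<in> Poly_Mapping.keys g" "m = j + k"
        using Poly_Mapping.keys_mult[of r g] by auto
      then show ?thesis using f(2) g' by (simp add: row2_degree_add add_less_le_mono)
    qed
  qed
  ultimately show ?thesis unfolding has_leading_def by blast
qed

lemma has_leading_lookup:
  assumes "has_leading f d"
  shows "Poly_Mapping.lookup f d = 1"
    and "m \<in> Poly_Mapping.keys f \<Longrightarrow> m \<noteq> d \<Longrightarrow> row2_degree m < row2_degree d"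
proof -
  obtain r where f: "f = monomial_poly d + r" "\<forall>m\<in>Poly_Mapping.keys r. row2_degree m < row2_degree d"
    using assms unfolding has_leading_def by auto
  then have "d \<notin> Poly_Mapping.keys r" by blast
  then show "Poly_Mapping.lookup f d = 1"
    by (simp add: f lookup_add monomial_poly_def in_keys_iff)
  show "row2_degree m < row2_degree d" if "m \<in> Poly_Mapping.keys f" "m \<noteq> d"
    using that f Poly_Mapping.keys_add[of "monomial_poly d" r] by (auto simp: monomial_poly_def)
qed

section \<open>Diagonal terms of products of minors\<close>

definition diag :: "(nat \<times> nat) monomial \<Rightarrow> (nat \<times> nat) monomial" where
  "diag M = (\<Sum>J\<in>Poly_Mapping.keys M.
     Poly_Mapping.single (1, fst J) (Poly_Mapping.lookup M J) +
     Poly_Mapping.single (2, snd J) (Poly_Mapping.lookup M J))"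

lemma diag_add: "diag (M + N) = diag M + diag N"
  unfolding diag_def by (rule setsum_keys_plus_distrib) (auto simp: single_add algebra_simps)

lemma diag_zero [simp]: "diag 0 = 0"
  by (simp add: diag_def)

lemma diag_single:
  "diag (Poly_Mapping.single J (Suc 0)) =
     Poly_Mapping.single (1, fst J) 1 + Poly_Mapping.single (2, snd J) 1"
  by (simp add: diag_def)

lemma keys_sum_nat:
  fixes f :: "'a \<Rightarrow> 'i monomial"
  assumes "finite A"
  shows "Poly_Mapping.keys (sum f A) = (\<Union>x\<in>A. Poly_Mapping.keys (f x))"
  using assms by induction (auto simp: keys_add_nat)

lemma keys_diag:
  "Poly_Mapping.keys (diag M) =
     (\<lambda>J. (1, fst J)) ` Poly_Mapping.keys M \<union> (\<lambda>J. (2, snd J)) ` Poly_Mapping.keys M"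
  by (auto simp: diag_def keys_sum_nat keys_add_nat in_keys_iff)

text \<open>For columns \<open>a < b\<close> the diagonal term has degree \<open>b\<close> and the
  antidiagonal one degree \<open>a\<close>.\<close>

lemma has_leading_minor:
  assumes "fst J < snd J"
  shows "has_leading (minor J) (diag (Poly_Mapping.single J 1))"
proof -
  obtain a b where J: "J = (a, b)" by fastforce
  let ?e = "Poly_Mapping.single (1::nat, b) (1::nat) + Poly_Mapping.single (2, a) 1"
  have "minor J = monomial_poly (diag (Poly_Mapping.single J 1)) + - monomial_poly ?e"
    by (simp add: J variable_def monomial_poly_def mult_single diag_single)
  moreover have "row2_degree m < row2_degree (diag (Poly_Mapping.single J 1))"
    if "m \<in> Poly_Mapping.keys (- monomial_poly ?e)" for m
    using that assms by (auto simp: J monomial_poly_def diag_single row2_degree_add in_keys_iff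
        lookup_single when_def split: if_splits)
  ultimately show ?thesis unfolding has_leading_def by blast
qed

lemma has_leading_monom_val_minor:
  assumes "M \<in> monomials (plucker_indices n)"
  shows "has_leading (monom_val minor M) (diag M)"
  using assms
proof (induction M rule: monomial_induct)
  case zero
  have "has_leading 1 0"
    unfolding has_leading_def by (intro exI[of _ 0]) (simp add: monomial_poly_def)
  then show ?case by simp
next
  case (add J M)
  then have "fst J < snd J" "M \<in> monomials (plucker_indices n)"
    by (auto simp: monomials_add plucker_indices_def)
  then show ?case
    using has_leading_mult[OF has_leading_minor add.IH, of J] by (simp add: monom_val_add diag_add)
qed

section \<open>Recovering a non-crossing monomial from its diagonal term\<close>

text \<open>
  The diagonal term records which indices open and which close an arc; the first closing index
  must be matched with the last opening index before it.
\<close>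

lemma innermost_arc:
  assumes M: "M \<in> monomials (plucker_indices n)" "non_crossing M" "M \<noteq> 0"
    and c: "c = Min {j. (2, j) \<in> Poly_Mapping.keys (diag M)}"
    and a: "a = Max {j. j < c \<and> (1, j) \<in> Poly_Mapping.keys (diag M)}"
  shows "(a, c) \<in> Poly_Mapping.keys M"
proof -
  let ?K = "Poly_Mapping.keys M"
  have K: "fst J < snd J" if "J \<in> ?K" for J
    using that M(1) by (auto simp: monomials_def plucker_indices_def)
  have C: "{j. (2, j) \<in> Poly_Mapping.keys (diag M)} = snd ` ?K"
    and A: "{j. j < c \<and> (1, j) \<in> Poly_Mapping.keys (diag M)} = {j \<in> fst ` ?K. j < c}"
    by (auto simp: keys_diag image_iff)
  have ne: "?K \<noteq> {}" using M(3) by simp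
  then have "c \<in> snd ` ?K" unfolding c C by (intro Min_in) auto
  then obtain a' where a': "(a', c) \<in> ?K" by auto
  have cmin: "c \<le> snd J" if "J \<in> ?K" for J unfolding c C using that by (intro Min_le) auto
  have a'A: "a' \<in> {j \<in> fst ` ?K. j < c}" using a' K[OF a'] by force
  then have "a \<in> {j \<in> fst ` ?K. j < c}" unfolding a A by (intro Max_in) auto
  then obtain c' where c': "(a, c') \<in> ?K" "a < c" by auto
  have "a' \<le> a" unfolding a A using a'A by (intro Max_ge) auto
  show ?thesis
  proof (rule ccontr)
    \<comment> \<open>The arc \<open>(a', c)\<close> and the arc \<open>(a, c')\<close> then differ
      at both ends, and the extremal choices of \<open>a\<close> and \<open>c\<close> force
      \<open>a' < a < c < c'\<close>, a crossing.\<close>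
    assume "(a, c) \<notin> ?K"
    then have "a' < a" "c < c'" using \<open>a' \<le> a\<close> a' c' cmin[OF c'(1)] by (auto simp: le_less)
    then show False using M(2) a' c' unfolding non_crossing_def by fastforce
  qed
qed

text \<open>Induction on the total degree: a common innermost arc is stripped from both monomials;
  the rests stay non-crossing and, by cancellation, keep equal diagonal terms.\<close>

lemma diag_inj_non_crossing:
  assumes "M \<in> monomials (plucker_indices n)" "non_crossing M"
    and "N \<in> monomials (plucker_indices n)" "non_crossing N"
    and "diag M = diag N"
  shows "M = N"
  using assms
proof (induction "\<Sum>i\<in>Poly_Mapping.keys M. Poly_Mapping.lookup M i" arbitrary: M N rule: less_induct)
  case less
  show ?case
  proof (cases "M = 0")
    case True
    then have "Poly_Mapping.keys (diag N) = {}" using less.prems(5) by simp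
    then show ?thesis using True by (simp add: keys_diag)
  next
    case False
    then have "Poly_Mapping.keys (diag N) \<noteq> {}"
      unfolding less.prems(5)[symmetric] by (simp add: keys_diag)
    then have N0: "N \<noteq> 0" by (auto simp: keys_diag)
    \<comment> \<open>\<open>innermost_arc\<close> computes its pair from the diagonal term alone,
      so both monomials contain the same pair.\<close>
    obtain J where J: "J \<in> Poly_Mapping.keys M" "J \<in> Poly_Mapping.keys N"
      using innermost_arc[OF less.prems(1,2) False refl refl]
        innermost_arc[OF less.prems(3,4) N0 refl refl] less.prems(5) by simp
    define s where "s = Poly_Mapping.single J (1::nat)"
    define M' N' where "M' = M - s" and "N' = N - s"
    have MN: "M = s + M'" "N = s + N'"
      using J[THEN single_plus_minus] by (simp_all add: s_def M'_def N'_def)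
    have "(\<Sum>i\<in>Poly_Mapping.keys M'. Poly_Mapping.lookup M' i) <
        (\<Sum>i\<in>Poly_Mapping.keys M. Poly_Mapping.lookup M i)"
      using sum_lookup_single_plus[of M J M'] MN(1) by (simp add: s_def)
    moreover have "M' \<in> monomials (plucker_indices n)" "N' \<in> monomials (plucker_indices n)"
      "diag M' = diag N'"
      using less.prems unfolding MN by (auto simp: monomials_add diag_add)
    moreover have "non_crossing M'" "non_crossing N'"
      by (rule non_crossing_mono[OF less.prems(2)], simp add: MN keys_add_nat)
        (rule non_crossing_mono[OF less.prems(4)], simp add: MN keys_add_nat)
    ultimately have "M' = N'" using less.hyps by blast
    then show ?thesis using MN by simp
  qed
qed

text \<open>Take \<open>M\<close> in \<open>g\<close> whose diagonal term has maximal degree. No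
  other monomial of \<open>g\<close> contributes to the coefficient of \<open>diag M\<close> after
  substitution, so that coefficient is the nonzero one of \<open>M\<close> in
  \<open>g\<close>.\<close>

lemma non_crossing_independent:
  assumes g: "Poly_Mapping.keys g \<subseteq> {N \<in> monomials (plucker_indices n). non_crossing N}"
    and "substitute minor g = 0"
  shows "g = 0"
proof (rule ccontr)
  assume "g \<noteq> 0"
  let ?K = "Poly_Mapping.keys g" and ?d = "\<lambda>M. row2_degree (diag M)"
  have "?K \<noteq> {}" using \<open>g \<noteq> 0\<close> by simp
  then have "Max (?d ` ?K) \<in> ?d ` ?K" by (intro Max_in) auto
  then obtain M where M: "M \<in> ?K" and "?d M = Max (?d ` ?K)" by auto
  then have max: "?d N \<le> ?d M" if "N \<in> ?K" for N using that by simp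
  \<comment> \<open>By injectivity \<open>diag M\<close> would be a non-leading term of the product
    for \<open>N\<close>, hence of smaller degree than \<open>diag N\<close>, against
    maximality.\<close>
  have zero: "Poly_Mapping.lookup (monom_val minor N) (diag M) = 0" if N: "N \<in> ?K" "N \<noteq> M" for N
  proof (rule ccontr)
    assume "Poly_Mapping.lookup (monom_val minor N) (diag M) \<noteq> 0"
    moreover have "diag M \<noteq> diag N" using diag_inj_non_crossing[of M n N] g M N by blast
    moreover have "has_leading (monom_val minor N) (diag N)"
      using has_leading_monom_val_minor g N by blast
    ultimately have "?d M < ?d N" using has_leading_lookup(2) by (simp add: in_keys_iff)
    then show False using max[OF N(1)] by simp
  qed
  have "0 = Poly_Mapping.lookup (substitute minor g) (diag M)" using assms(2) by simp
  also have "\<dots> = (\<Sum>N\<in>?K. Poly_Mapping.lookup g N * Poly_Mapping.lookup (monom_val minor N) (diag M))"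
    by (simp add: substitute_altdef lookup_sum lookup_const_mult)
  also have "\<dots> = Poly_Mapping.lookup g M * Poly_Mapping.lookup (monom_val minor M) (diag M)"
    using zero M by (subst sum.remove[OF _ M]) auto
  also have "\<dots> = Poly_Mapping.lookup g M"
    using has_leading_lookup(1)[OF has_leading_monom_val_minor[of M n]] g M by auto
  finally show False using M by (simp add: in_keys_iff)
qed


section \<open>Initial monomials\<close>

text \<open>Straightening every term of \<open>f\<close> gives an \<open>h\<close> that vanishes by
  independence. A non-crossing \<open>N\<close> of maximal weight would keep its coefficient: the
  other non-crossing terms stay fixed, and crossing terms produce only monomials lighter than
  themselves.\<close>

lemma heaviest_monomial_crossing:
  assumes f: "f \<in> plucker_ideal n" and N: "N \<in> Poly_Mapping.keys f"
    and max: "\<And>M. M \<in> Poly_Mapping.keys f \<Longrightarrow> weight M \<le> weight N"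
  shows "\<not> non_crossing N"
proof
  assume nc: "non_crossing N"
  let ?X = "monomials (plucker_indices n)"
  have fX: "Poly_Mapping.keys f \<subseteq> ?X" and f0: "substitute minor f = 0"
    using f by (auto simp: plucker_ideal_iff)
  let ?P = "\<lambda>M g. Poly_Mapping.keys g \<subseteq> {N \<in> ?X. non_crossing N} \<and>
    (if non_crossing M then g = monomial_poly M else \<forall>N\<in>Poly_Mapping.keys g. weight N < weight M) \<and>
    substitute minor g = monom_val minor M"
  have "\<forall>M\<in>?X. \<exists>g. ?P M g" using straightening by (intro ballI)
  from bchoice[OF this] obtain G where "\<forall>M\<in>?X. ?P M (G M)" by (rule exE)
  note G' = bspec[OF this]
  have G: "Poly_Mapping.keys (G M) \<subseteq> {N \<in> ?X. non_crossing N}"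
      "substitute minor (G M) = monom_val minor M" if "M \<in> ?X" for M
    using G'[OF that] by blast+
  have G_nc: "G M = monomial_poly M" if "M \<in> ?X" "non_crossing M" for M
    using G'[OF that(1)] that(2) by presburger
  have G_cr: "weight N < weight M"
    if "M \<in> ?X" "\<not> non_crossing M" "N \<in> Poly_Mapping.keys (G M)" for M N
    using G'[OF that(1)] that(2,3) by simp
  \<comment> \<open>The straightened form of \<open>f\<close>: each monomial is replaced by its
    chosen expansion \<open>G M\<close>, which has the same image under substitution.\<close>
  define h where "h = (\<Sum>M\<in>Poly_Mapping.keys f. Poly_Mapping.single 0 (Poly_Mapping.lookup f M) * G M)"
  have lh: "Poly_Mapping.lookup h L =
      (\<Sum>M\<in>Poly_Mapping.keys f. Poly_Mapping.lookup f M * Poly_Mapping.lookup (G M) L)" for L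
    by (simp add: h_def lookup_sum lookup_const_mult)
  have "substitute minor h = substitute minor f"
    unfolding h_def substitute_sum substitute_const_mult substitute_altdef[of _ f]
    using fX G(2) by (intro sum.cong) auto
  moreover have "Poly_Mapping.keys h \<subseteq> {N \<in> ?X. non_crossing N}"
  proof
    fix L assume "L \<in> Poly_Mapping.keys h"
    then obtain M where M: "M \<in> Poly_Mapping.keys f" "Poly_Mapping.lookup (G M) L \<noteq> 0"
      unfolding in_keys_iff[of L] lh by (auto elim!: sum.not_neutral_contains_not_neutral)
    then show "L \<in> {N \<in> ?X. non_crossing N}" using G(1)[OF subsetD[OF fX M(1)]] by (auto simp: in_keys_iff)
  qed
  ultimately have "h = 0" using non_crossing_independent f0 by simp
  have "Poly_Mapping.lookup (G M) N = 0" if M: "M \<in> Poly_Mapping.keys f" "M \<noteq> N" for M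
  proof (cases "non_crossing M")
    case True
    then show ?thesis using G_nc M fX by (auto simp: monomial_poly_def lookup_single)
  next
    case False
    then show ?thesis using G_cr[of M N] max[of M] M fX by (fastforce simp: in_keys_iff)
  qed
  then have "Poly_Mapping.lookup h N = Poly_Mapping.lookup f N * Poly_Mapping.lookup (G N) N"
    unfolding lh by (subst sum.remove[OF _ N]) auto
  also have "\<dots> = Poly_Mapping.lookup f N"
    using G_nc nc N fX by (auto simp: monomial_poly_def)
  finally show False using N \<open>h = 0\<close> by (simp add: in_keys_iff)
qed

section \<open>Existence and uniqueness of the initial monomial\<close>

lemma initial_monomial_eqI:
  assumes "irreflp_on X prec" "transp_on X prec" "Poly_Mapping.keys f \<subseteq> X"
    and "M \<in> Poly_Mapping.keys f" "\<And>L. L \<in> Poly_Mapping.keys f \<Longrightarrow> L \<noteq> M \<Longrightarrow> prec M L"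
  shows "initial_monomial prec f = M"
  unfolding initial_monomial_def
proof (rule the_equality)
  fix L assume L: "L \<in> Poly_Mapping.keys f \<and> (\<forall>M'\<in>Poly_Mapping.keys f. M' \<noteq> L \<longrightarrow> prec L M')"
  show "L = M"
  proof (rule ccontr)
    assume "L \<noteq> M"
    then have "prec L M" "prec M L" using L assms(4,5) by auto
    then have "prec M M" using assms(2-4) L by (meson subsetD transp_onD)
    then show False using assms(1,3,4) by (meson subsetD irreflp_onD)
  qed
qed (use assms in auto)

lemma initial_monomial_least:
  assumes o: "irreflp_on X prec" "transp_on X prec" "totalp_on X prec"
    and f: "Poly_Mapping.keys f \<subseteq> X" "f \<noteq> 0"
  shows "initial_monomial prec f \<in> Poly_Mapping.keys f"
    and "L \<in> Poly_Mapping.keys f \<Longrightarrow> L \<noteq> initial_monomial prec f \<Longrightarrow> prec (initial_monomial prec f) L"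
proof -
  let ?K = "Poly_Mapping.keys f"
  \<comment> \<open>A minimum exists because the support is finite; asymmetry follows from
    irreflexivity and transitivity.\<close>
  have "asymp_on ?K prec" "transp_on ?K prec" "totalp_on ?K prec"
    using o f(1) by (meson asymp_on_subset asymp_on_iff_irreflp_on_if_transp_on,
        meson transp_on_subset, meson totalp_on_subset)
  moreover have "?K \<noteq> {}" using f(2) by simp
  ultimately obtain M where M: "M \<in> ?K" "\<forall>L\<in>?K. L \<noteq> M \<longrightarrow> prec M L"
    using Finite_Set.bex_least_element[of ?K prec] by auto
  then have "initial_monomial prec f = M" using initial_monomial_eqI[OF o(1,2) f(1)] by blast
  then show "initial_monomial prec f \<in> ?K"
    "L \<in> ?K \<Longrightarrow> L \<noteq> initial_monomial prec f \<Longrightarrow> prec (initial_monomial prec f) L"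
    using M by auto
qed

text \<open>A heavier monomial of \<open>f\<close> would precede the initial one, so the initial
  monomial has maximal weight and \<open>heaviest_monomial_crossing\<close> applies.\<close>

lemma initial_monomial_crossing:
  assumes o: "reverse_weight_order n prec" and f: "f \<in> plucker_ideal n" "f \<noteq> 0"
  shows "initial_monomial prec f \<in> {M \<in> monomials (plucker_indices n). \<not> non_crossing M}"
proof -
  let ?X = "monomials (plucker_indices n)" and ?N = "initial_monomial prec f"
  have o': "irreflp_on ?X prec" "transp_on ?X prec" "totalp_on ?X prec"
    and w: "\<And>M M'. M \<in> ?X \<Longrightarrow> M' \<in> ?X \<Longrightarrow> weight M > weight M' \<Longrightarrow> prec M M'"
    using o by (auto simp: reverse_weight_order_def Let_def)
  have fX: "Poly_Mapping.keys f \<subseteq> ?X" using f by (simp add: plucker_ideal_iff)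
  note least = initial_monomial_least[OF o' fX f(2)]
  have "weight M \<le> weight ?N" if M: "M \<in> Poly_Mapping.keys f" for M
  proof (rule ccontr)
    assume "\<not> weight M \<le> weight ?N"
    then have "prec M ?N" "prec ?N M" using w least M fX by (auto simp: subset_iff)
    then have "prec M M" using o'(2) fX least(1) M by (meson subsetD transp_onD)
    then show False using o'(1) fX M by (meson subsetD irreflp_onD)
  qed
  then show ?thesis using heaviest_monomial_crossing[OF f(1) least(1)] fX least(1) by auto
qed

text \<open>A crossing survives in every multiple, which gives absorption. This ideal serves as an
  upper bound for the initial ideal.\<close>

lemma crossing_polynomials_ideal:
  "ideal {f. Poly_Mapping.keys f \<subseteq> {M \<in> monomials (plucker_indices n). \<not> non_crossing M}}
     (poly_ring (plucker_indices n))" (is "ideal ?T ?R")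
proof -
  interpret cring ?R by (rule cring_poly_ring)
  have mult: "g * f \<in> ?T" if "f \<in> ?T" "g \<in> carrier ?R" for f g
  proof -
    have "L \<in> monomials (plucker_indices n) \<and> \<not> non_crossing L" if L: "L \<in> Poly_Mapping.keys (g * f)" for L
    proof -
      obtain j k where "j \<in> Poly_Mapping.keys g" "k \<in> Poly_Mapping.keys f" "L = j + k"
        using L Poly_Mapping.keys_mult[of g f] by auto
      then show ?thesis
        using \<open>f \<in> ?T\<close> \<open>g \<in> carrier ?R\<close> non_crossing_mono[of L k]
        by (auto simp: poly_ring_def monomials_add keys_add_nat)
    qed
    then show ?thesis by blast
  qed
  show ?thesis
  proof (rule idealI)
    show "ring ?R" by (rule ring_axioms)
    show "subgroup ?T (add_monoid ?R)"
    proof (rule add.subgroupI)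
      show "?T \<subseteq> carrier ?R" by (auto simp: poly_ring_def)
      show "?T \<noteq> {}" by (auto intro: exI[of _ 0])
    next
      fix f assume "f \<in> ?T"
      moreover have "\<ominus>\<^bsub>?R\<^esub> f = - f"
        using \<open>f \<in> ?T\<close> by (intro minus_equality) (auto simp: poly_ring_def)
      ultimately show "\<ominus>\<^bsub>?R\<^esub> f \<in> ?T" by simp
    next
      fix f g assume "f \<in> ?T" "g \<in> ?T"
      then show "f \<oplus>\<^bsub>?R\<^esub> g \<in> ?T"
        using Poly_Mapping.keys_add[of f g] by (auto simp: poly_ring_def)
    qed
  next
    fix f g assume fg: "f \<in> ?T" "g \<in> carrier ?R"
    show "g \<otimes>\<^bsub>?R\<^esub> f \<in> ?T" using mult[OF fg] by (simp add: poly_ring_def)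
    show "f \<otimes>\<^bsub>?R\<^esub> g \<in> ?T" using mult[OF fg] by (simp add: poly_ring_def mult.commute)
  qed
qed

text \<open>The witness is a monomial multiple of one Pluecker relation; its other two terms are
  strictly lighter than \<open>M\<close>, so ties do not matter.\<close>

lemma crossing_is_initial:
  assumes o: "reverse_weight_order n prec"
    and M: "M \<in> monomials (plucker_indices n)" "\<not> non_crossing M"
  shows "\<exists>f. f \<in> plucker_ideal n \<and> f \<noteq> 0 \<and> initial_monomial prec f = M"
proof -
  let ?X = "monomials (plucker_indices n)"
  have o': "irreflp_on ?X prec" "transp_on ?X prec"
    and w: "\<And>M M'. M \<in> ?X \<Longrightarrow> M' \<in> ?X \<Longrightarrow> weight M > weight M' \<Longrightarrow> prec M M'"
    using o by (auto simp: reverse_weight_order_def Let_def)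
  obtain M1 M2 where m: "M1 \<in> ?X" "M2 \<in> ?X" "weight M1 < weight M" "weight M2 < weight M"
    and e: "monom_val minor M = monom_val minor M1 + monom_val minor M2"
    using resolve_crossing[OF M] by blast
  define f where "f = monomial_poly M - monomial_poly M1 - monomial_poly M2"
  have keys: "Poly_Mapping.keys f \<subseteq> {M, M1, M2}"
    by (auto simp: f_def monomial_poly_def in_keys_iff lookup_minus lookup_single when_def
        split: if_splits)
  \<comment> \<open>\<open>M\<close> differs from \<open>M1\<close> and \<open>M2\<close> by weight,
    so its coefficient 1 survives.\<close>
  have MK: "M \<in> Poly_Mapping.keys f"
    using m by (auto simp: f_def monomial_poly_def in_keys_iff lookup_minus lookup_single when_def)
  have fX: "Poly_Mapping.keys f \<subseteq> ?X" using keys M m by auto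
  have "f \<in> plucker_ideal n"
    using fX by (simp add: plucker_ideal_iff) (simp add: f_def substitute_diff substitute_monomial_poly e)
  moreover have "f \<noteq> 0" using MK by auto
  moreover have "initial_monomial prec f = M"
    by (rule initial_monomial_eqI[OF o' fX MK]) (use keys w m M in blast)
  ultimately show ?thesis by blast
qed

theorem theorem30:
  fixes n :: nat
    and prec :: "(nat \<times> nat) monomial \<Rightarrow> (nat \<times> nat) monomial \<Rightarrow> bool"
  assumes "n \<ge> 1"
    and "reverse_weight_order n prec"
  shows "{M \<in> monomials (plucker_indices n). non_crossing M} =
         non_initial_monomials (plucker_indices n) prec (plucker_ideal n)"
proof -
  let ?X = "monomials (plucker_indices n)" and ?R = "poly_ring (plucker_indices n)"
  let ?S = "{monomial_poly (initial_monomial prec f) |f. f \<in> plucker_ideal n \<and> f \<noteq> 0}"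
  let ?T = "{f. Poly_Mapping.keys f \<subseteq> {M \<in> ?X. \<not> non_crossing M}}"
  interpret cring ?R by (rule cring_poly_ring)
  have ST: "?S \<subseteq> ?T"
    using initial_monomial_crossing[OF assms(2)] by (auto simp: monomial_poly_def)
  \<comment> \<open>Minimality of the generated ideal keeps every non-crossing monomial out of it;
    conversely, each crossing monomial is itself a generator.\<close>
  have "genideal ?R ?S \<subseteq> ?T" by (rule genideal_minimal[OF crossing_polynomials_ideal ST])
  moreover have "?S \<subseteq> genideal ?R ?S"
    by (rule genideal_self) (use ST in \<open>auto simp: poly_ring_def\<close>)
  ultimately have "monomial_poly M \<in> genideal ?R ?S \<longleftrightarrow> \<not> non_crossing M" if "M \<in> ?X" for M
    using crossing_is_initial[OF assms(2) that] by (fastforce simp: monomial_poly_def)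
  then show ?thesis by (auto simp: non_initial_monomials_def initial_ideal_def)
qed

end
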